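(* Let $A$ be a ring and let $X$ be a $\Sigma$-d-Rickart $A$-module. Then the endomorphism ring $S=\operatorname{End}_A(X)$ is left semi-hereditary.
   Context: Rings are associative with unity and modules are unital right $A$-modules; endomorphisms of $X$ act on the left, so that $X$ is a left $S$-module. A module $M$ is d-Rickart if $\operatorname{Im}(\phi)$ is a direct summand of $M$ for every $\phi\in\operatorname{End}_A(M)$. A module $X$ is $\Sigma$-d-Rickart if the direct sum $X^{(\Lambda)}$ of $\Lambda$ copies of $X$ is d-Rickart for every non-empty index set $\Lambda$. A ring is left semi-hereditary if each of its finitely generated left ideals is projective. *)

theory Defs
  imports
    "HOL-Library.Infinite_Typeclass"
    "HOL-Algebra.Ideal"
    "HOL-Algebra.Module"
    "HOL-Algebra.Product_Groups"
begin

text \<open>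
  The locale \<^locale>\<open>module\<close> of HOL-Algebra requires a commutative ring of scalars, so left and
  right modules over an arbitrary unital ring are introduced here. As in the record
  \<^typ>\<open>('a, 'b) module\<close>, the components \<^const>\<open>mult\<close> and \<^const>\<open>one\<close> of a module carry no
  meaning.
\<close>

section \<open>Right modules and their endomorphisms\<close>

record ('a, 'b) rmodule = "'b ring" +
  rsmult :: "['b, 'a] \<Rightarrow> 'b" (infixl \<open>\<odot>r\<index>\<close> 70)

locale right_module = R?: ring A + M?: abelian_group M for A (structure) and M (structure) +
  assumes rsmult_closed [simp, intro]:
      "\<lbrakk>x \<in> carrier M; a \<in> carrier A\<rbrakk> \<Longrightarrow> x \<odot>r\<^bsub>M\<^esub> a \<in> carrier M"
    and rsmult_l_distr:
      "\<lbrakk>x \<in> carrier M; y \<in> carrier M; a \<in> carrier A\<rbrakk>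
        \<Longrightarrow> (x \<oplus>\<^bsub>M\<^esub> y) \<odot>r\<^bsub>M\<^esub> a = x \<odot>r\<^bsub>M\<^esub> a \<oplus>\<^bsub>M\<^esub> y \<odot>r\<^bsub>M\<^esub> a"
    and rsmult_r_distr:
      "\<lbrakk>x \<in> carrier M; a \<in> carrier A; b \<in> carrier A\<rbrakk>
        \<Longrightarrow> x \<odot>r\<^bsub>M\<^esub> (a \<oplus>\<^bsub>A\<^esub> b) = x \<odot>r\<^bsub>M\<^esub> a \<oplus>\<^bsub>M\<^esub> x \<odot>r\<^bsub>M\<^esub> b"
    and rsmult_assoc:
      "\<lbrakk>x \<in> carrier M; a \<in> carrier A; b \<in> carrier A\<rbrakk>
        \<Longrightarrow> x \<odot>r\<^bsub>M\<^esub> (a \<otimes>\<^bsub>A\<^esub> b) = (x \<odot>r\<^bsub>M\<^esub> a) \<odot>r\<^bsub>M\<^esub> b"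
    and rsmult_one [simp]:
      "x \<in> carrier M \<Longrightarrow> x \<odot>r\<^bsub>M\<^esub> \<one>\<^bsub>A\<^esub> = x"

definition right_module_hom ::
    "('a, 'c) ring_scheme \<Rightarrow> ('a, 'x, 'd) rmodule_scheme \<Rightarrow> ('a, 'y, 'e) rmodule_scheme
      \<Rightarrow> ('x \<Rightarrow> 'y) set"
  where "right_module_hom A M N =
    {f \<in> hom (add_monoid M) (add_monoid N).
      \<forall>x\<in>carrier M. \<forall>a\<in>carrier A. f (x \<odot>r\<^bsub>M\<^esub> a) = f x \<odot>r\<^bsub>N\<^esub> a}"

text \<open>
  Maps are taken to be \<^const>\<open>extensional\<close>, so that endomorphisms that agree on the carrier are
  equal. The product of \<open>f\<close> and \<open>g\<close> is \<open>x \<mapsto> f (g x)\<close>: endomorphisms act on the left.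
\<close>

definition endo_ring ::
    "('a, 'c) ring_scheme \<Rightarrow> ('a, 'x, 'd) rmodule_scheme \<Rightarrow> ('x \<Rightarrow> 'x) ring"
  where "endo_ring A M =
    \<lparr>carrier = right_module_hom A M M \<inter> extensional (carrier M),
     mult = (\<lambda>f g. compose (carrier M) f g),
     one = (\<lambda>x\<in>carrier M. x),
     zero = (\<lambda>x\<in>carrier M. \<zero>\<^bsub>M\<^esub>),
     add = (\<lambda>f g. \<lambda>x\<in>carrier M. f x \<oplus>\<^bsub>M\<^esub> g x)\<rparr>"

definition right_submodule ::
    "('a, 'c) ring_scheme \<Rightarrow> ('a, 'x, 'd) rmodule_scheme \<Rightarrow> 'x set \<Rightarrow> bool"
  where "right_submodule A M N \<longleftrightarrow>
    additive_subgroup N M \<and> (\<forall>x\<in>N. \<forall>a\<in>carrier A. x \<odot>r\<^bsub>M\<^esub> a \<in> N)"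

definition direct_summand ::
    "('a, 'c) ring_scheme \<Rightarrow> ('a, 'x, 'd) rmodule_scheme \<Rightarrow> 'x set \<Rightarrow> bool"
  where "direct_summand A M N \<longleftrightarrow>
    right_submodule A M N \<and>
    (\<exists>N'. right_submodule A M N' \<and> N <+>\<^bsub>M\<^esub> N' = carrier M \<and> N \<inter> N' = {\<zero>\<^bsub>M\<^esub>})"

section \<open>d-Rickart and \<open>\<Sigma>\<close>-d-Rickart modules\<close>

definition d_rickart ::
    "('a, 'c) ring_scheme \<Rightarrow> ('a, 'x, 'd) rmodule_scheme \<Rightarrow> bool"
  where "d_rickart A M \<longleftrightarrow>
    right_module A M \<and>
    (\<forall>\<phi>\<in>carrier (endo_ring A M). direct_summand A M (\<phi> ` carrier M))"

definition direct_sum_copies ::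
    "'i set \<Rightarrow> ('a, 'x, 'd) rmodule_scheme \<Rightarrow> ('a, 'i \<Rightarrow> 'x) rmodule"
  where "direct_sum_copies \<Lambda> M =
    \<lparr>carrier = carrier (sum_group \<Lambda> (\<lambda>_. add_monoid M)),
     mult = undefined,
     one = undefined,
     zero = \<one>\<^bsub>sum_group \<Lambda> (\<lambda>_. add_monoid M)\<^esub>,
     add = mult (sum_group \<Lambda> (\<lambda>_. add_monoid M)),
     rsmult = (\<lambda>f a. \<lambda>i\<in>\<Lambda>. f i \<odot>r\<^bsub>M\<^esub> a)\<rparr>"

text \<open>
  HOL cannot quantify over all index sets inside a formula, so the type \<open>'i\<close> of indices is a
  parameter and \<open>\<Lambda>\<close> ranges over the non-empty subsets of \<open>'i\<close>, of every cardinality up to that of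
  \<open>'i\<close>. The type is required to be infinite: over a one-element type the notion would collapse to
  that of a d-Rickart module.
\<close>

definition sigma_d_rickart ::
    "'i::infinite itself \<Rightarrow> ('a, 'c) ring_scheme \<Rightarrow> ('a, 'x, 'd) rmodule_scheme \<Rightarrow> bool"
  where "sigma_d_rickart TYPE('i) A M \<longleftrightarrow>
    (\<forall>\<Lambda> :: 'i set. \<Lambda> \<noteq> {} \<longrightarrow> d_rickart A (direct_sum_copies \<Lambda> M))"

section \<open>Left modules, left ideals and left semi-hereditary rings\<close>

locale left_module = R?: ring R + M?: abelian_group M for R (structure) and M (structure) +
  assumes lsmult_closed [simp, intro]:
      "\<lbrakk>a \<in> carrier R; x \<in> carrier M\<rbrakk> \<Longrightarrow> a \<odot>\<^bsub>M\<^esub> x \<in> carrier M"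
    and lsmult_l_distr:
      "\<lbrakk>a \<in> carrier R; b \<in> carrier R; x \<in> carrier M\<rbrakk>
        \<Longrightarrow> (a \<oplus>\<^bsub>R\<^esub> b) \<odot>\<^bsub>M\<^esub> x = a \<odot>\<^bsub>M\<^esub> x \<oplus>\<^bsub>M\<^esub> b \<odot>\<^bsub>M\<^esub> x"
    and lsmult_r_distr:
      "\<lbrakk>a \<in> carrier R; x \<in> carrier M; y \<in> carrier M\<rbrakk>
        \<Longrightarrow> a \<odot>\<^bsub>M\<^esub> (x \<oplus>\<^bsub>M\<^esub> y) = a \<odot>\<^bsub>M\<^esub> x \<oplus>\<^bsub>M\<^esub> a \<odot>\<^bsub>M\<^esub> y"
    and lsmult_assoc:
      "\<lbrakk>a \<in> carrier R; b \<in> carrier R; x \<in> carrier M\<rbrakk>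
        \<Longrightarrow> (a \<otimes>\<^bsub>R\<^esub> b) \<odot>\<^bsub>M\<^esub> x = a \<odot>\<^bsub>M\<^esub> (b \<odot>\<^bsub>M\<^esub> x)"
    and lsmult_one [simp]:
      "x \<in> carrier M \<Longrightarrow> \<one>\<^bsub>R\<^esub> \<odot>\<^bsub>M\<^esub> x = x"

definition left_module_hom ::
    "('r, 'c) ring_scheme \<Rightarrow> ('r, 'x, 'd) module_scheme \<Rightarrow> ('r, 'y, 'e) module_scheme
      \<Rightarrow> ('x \<Rightarrow> 'y) set"
  where "left_module_hom R M N =
    {f \<in> hom (add_monoid M) (add_monoid N).
      \<forall>a\<in>carrier R. \<forall>x\<in>carrier M. f (a \<odot>\<^bsub>M\<^esub> x) = a \<odot>\<^bsub>N\<^esub> f x}"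

text \<open>
  Projectivity is the lifting property against surjections \<open>g : N \<rightarrow> L\<close>. The element types \<open>'n\<close>
  and \<open>'l\<close> of the test modules have to be parameters of the definition; a theorem that concludes
  projectivity with both of them free asserts the lifting property for all test modules.
\<close>

definition projective_left_module ::
    "'n itself \<Rightarrow> 'l itself \<Rightarrow> ('r, 'c) ring_scheme \<Rightarrow> ('r, 'p, 'd) module_scheme \<Rightarrow> bool"
  where "projective_left_module TYPE('n) TYPE('l) R P \<longleftrightarrow>
    left_module R P \<and>
    (\<forall>(N :: ('r, 'n) module) (L :: ('r, 'l) module).
      left_module R N \<longrightarrow> left_module R L \<longrightarrow>
      (\<forall>g\<in>left_module_hom R N L. \<forall>f\<in>left_module_hom R P L.
        g ` carrier N = carrier L \<longrightarrow>
        (\<exists>h\<in>left_module_hom R P N. \<forall>x\<in>carrier P. g (h x) = f x)))"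

definition left_ideal :: "('r, 'c) ring_scheme \<Rightarrow> 'r set \<Rightarrow> bool"
  where "left_ideal R I \<longleftrightarrow>
    additive_subgroup I R \<and> (\<forall>a\<in>carrier R. \<forall>x\<in>I. a \<otimes>\<^bsub>R\<^esub> x \<in> I)"

definition left_ideal_generated :: "('r, 'c) ring_scheme \<Rightarrow> 'r set \<Rightarrow> 'r set"
  where "left_ideal_generated R G = \<Inter> {I. left_ideal R I \<and> G \<subseteq> I}"

definition fg_left_ideal :: "('r, 'c) ring_scheme \<Rightarrow> 'r set \<Rightarrow> bool"
  where "fg_left_ideal R I \<longleftrightarrow>
    left_ideal R I \<and> (\<exists>G. finite G \<and> G \<subseteq> carrier R \<and> I = left_ideal_generated R G)"

definition left_ideal_module :: "('r, 'c) ring_scheme \<Rightarrow> 'r set \<Rightarrow> ('r, 'r) module"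
  where "left_ideal_module R I =
    \<lparr>carrier = I, mult = mult R, one = \<one>\<^bsub>R\<^esub>, zero = \<zero>\<^bsub>R\<^esub>, add = add R, smult = mult R\<rparr>"

definition left_semi_hereditary ::
    "'n itself \<Rightarrow> 'l itself \<Rightarrow> ('r, 'c) ring_scheme \<Rightarrow> bool"
  where "left_semi_hereditary TYPE('n) TYPE('l) R \<longleftrightarrow>
    ring R \<and>
    (\<forall>I. fg_left_ideal R I \<longrightarrow>
      projective_left_module TYPE('n) TYPE('l) R (left_ideal_module R I))"

section \<open>Well-definedness of the constructions\<close>

lemma (in right_module) endo_ring_is_ring: "ring (endo_ring A M)"
proof (rule ringI)
  have neg: "(\<ominus>\<^bsub>M\<^esub> x) \<odot>r\<^bsub>M\<^esub> a = \<ominus>\<^bsub>M\<^esub> (x \<odot>r\<^bsub>M\<^esub> a)" if "x \<in> carrier M" "a \<in> carrier A" for x a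
  proof -
    have z: "\<zero>\<^bsub>M\<^esub> \<odot>r\<^bsub>M\<^esub> a = \<zero>\<^bsub>M\<^esub>"
      using rsmult_l_distr[of "\<zero>\<^bsub>M\<^esub>" "\<zero>\<^bsub>M\<^esub>" a] that
      by (metis M.add.l_cancel_one M.l_zero M.zero_closed rsmult_closed)
    have "(\<ominus>\<^bsub>M\<^esub> x) \<odot>r\<^bsub>M\<^esub> a \<oplus>\<^bsub>M\<^esub> x \<odot>r\<^bsub>M\<^esub> a = \<zero>\<^bsub>M\<^esub>"
      using that by (simp add: rsmult_l_distr[symmetric] M.l_neg z)
    then show ?thesis using that by (simp add: M.minus_equality)
  qed
  have zero: "\<zero>\<^bsub>M\<^esub> \<odot>r\<^bsub>M\<^esub> a = \<zero>\<^bsub>M\<^esub>" if "a \<in> carrier A" for a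
    using rsmult_l_distr[of "\<zero>\<^bsub>M\<^esub>" "\<zero>\<^bsub>M\<^esub>" a] that
    by (metis M.add.l_cancel_one M.l_zero M.zero_closed rsmult_closed)
  show "abelian_group (endo_ring A M)"
  proof (rule abelian_groupI)
    fix f assume f: "f \<in> carrier (endo_ring A M)"
    have "(\<lambda>x\<in>carrier M. \<ominus>\<^bsub>M\<^esub> f x) \<in> carrier (endo_ring A M)"
      using f by (auto simp: endo_ring_def right_module_hom_def hom_def Pi_iff neg M.minus_add)
    moreover have "(\<lambda>x\<in>carrier M. \<ominus>\<^bsub>M\<^esub> f x) \<oplus>\<^bsub>endo_ring A M\<^esub> f = \<zero>\<^bsub>endo_ring A M\<^esub>"
      using f by (auto simp: endo_ring_def right_module_hom_def hom_def Pi_iff fun_eq_iff M.l_neg)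
    ultimately show "\<exists>g\<in>carrier (endo_ring A M). g \<oplus>\<^bsub>endo_ring A M\<^esub> f = \<zero>\<^bsub>endo_ring A M\<^esub>" by blast
  qed (auto simp: endo_ring_def right_module_hom_def hom_def Pi_iff extensional_def fun_eq_iff
        M.a_ac rsmult_l_distr zero)
  show "monoid (endo_ring A M)"
    by (rule monoidI)
      (auto simp: endo_ring_def right_module_hom_def hom_def Pi_iff extensional_def fun_eq_iff compose_def)
qed (auto simp: endo_ring_def right_module_hom_def hom_def Pi_iff extensional_def fun_eq_iff compose_def)

lemma (in right_module) direct_sum_copies_right_module:
  "right_module A (direct_sum_copies \<Lambda> M)"
proof -
  let ?S = "direct_sum_copies \<Lambda> M"
  have grp: "group (add_monoid M)" by (rule M.a_group)
  have carr: "carrier ?S = {x \<in> \<Pi>\<^sub>E i\<in>\<Lambda>. carrier M. finite {i \<in> \<Lambda>. x i \<noteq> \<zero>\<^bsub>M\<^esub>}}"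
    by (simp add: direct_sum_copies_def carrier_sum_group grp)
  interpret G: group "sum_group \<Lambda> (\<lambda>_. add_monoid M)" by (simp add: grp)
  have zero: "\<zero>\<^bsub>M\<^esub> \<odot>r\<^bsub>M\<^esub> a = \<zero>\<^bsub>M\<^esub>" if "a \<in> carrier A" for a
    using rsmult_l_distr[of "\<zero>\<^bsub>M\<^esub>" "\<zero>\<^bsub>M\<^esub>" a] that
    by (metis M.add.l_cancel_one M.l_zero M.zero_closed rsmult_closed)
  have "comm_group (sum_group \<Lambda> (\<lambda>_. add_monoid M))"
    by (rule G.group_comm_groupI) (auto simp: carrier_sum_group grp PiE_iff M.a_comm intro!: restrict_ext)
  then interpret G: comm_group "sum_group \<Lambda> (\<lambda>_. add_monoid M)" .
  have ab: "abelian_group ?S"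
    using G.m_closed G.one_closed G.m_assoc G.m_comm G.l_one G.l_inv_ex
    unfolding direct_sum_copies_def by (intro abelian_groupI) (simp_all del: mult_sum_group one_sum_group)
  show ?thesis
  proof (intro right_module.intro ab R.ring_axioms right_module_axioms.intro)
    fix x a assume x: "x \<in> carrier ?S" and a: "a \<in> carrier A"
    have "{i \<in> \<Lambda>. x i \<odot>r\<^bsub>M\<^esub> a \<noteq> \<zero>\<^bsub>M\<^esub>} \<subseteq> {i \<in> \<Lambda>. x i \<noteq> \<zero>\<^bsub>M\<^esub>}" using a zero by auto
    then have "finite {i \<in> \<Lambda>. x i \<odot>r\<^bsub>M\<^esub> a \<noteq> \<zero>\<^bsub>M\<^esub>}" using x carr by (auto intro: finite_subset)
    then have "(\<lambda>i\<in>\<Lambda>. x i \<odot>r\<^bsub>M\<^esub> a) \<in> carrier ?S"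
      using x a by (auto simp: carr PiE_iff cong: conj_cong)
    then show "x \<odot>r\<^bsub>?S\<^esub> a \<in> carrier ?S" by (simp add: direct_sum_copies_def)
  qed (auto simp: carrier_sum_group grp PiE_iff direct_sum_copies_def rsmult_l_distr rsmult_r_distr rsmult_assoc
       extensional_def fun_eq_iff)
qed

lemma (in ring) left_ideal_module_left_module:
  assumes "left_ideal R I"
  shows "left_module R (left_ideal_module R I)"
proof -
  interpret I: additive_subgroup I R using assms by (simp add: left_ideal_def)
  have sub: "x \<in> carrier R" if "x \<in> I" for x using I.a_subset that by auto
  show ?thesis
  proof (intro left_module.intro ring_axioms left_module_axioms.intro abelian_groupI)
    fix x assume x: "x \<in> carrier (left_ideal_module R I)"
    then show "\<exists>y\<in>carrier (left_ideal_module R I). y \<oplus>\<^bsub>left_ideal_module R I\<^esub> x = \<zero>\<^bsub>left_ideal_module R I\<^esub>"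
      using I.a_inv_closed[of x] by (auto simp: left_ideal_module_def sub l_neg intro!: bexI[of _ "\<ominus> x"])
  qed (use assms in \<open>auto simp: left_ideal_module_def left_ideal_def sub a_ac l_distr r_distr m_assoc\<close>)
qed

lemma (in ring) left_ideal_left_ideal_generated:
  assumes "G \<subseteq> carrier R"
  shows "left_ideal R (left_ideal_generated R G)"
proof -
  have "additive_subgroup (carrier R) R"
    by (simp add: additive_subgroup_def add.subgroup_self)
  then have "left_ideal R (carrier R)" by (simp add: left_ideal_def)
  then have ne: "{I. left_ideal R I \<and> G \<subseteq> I} \<noteq> {}" using assms by auto
  then show ?thesis
    unfolding left_ideal_generated_def left_ideal_def additive_subgroup_def
    by (auto intro!: add.subgroups_Inter)
qed

end

theory Submission
  imports Defs
begin

text \<open>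
  Let \<open>s\<^sub>1, \<dots>, s\<^sub>n\<close> generate a left ideal of \<open>S\<close> and let \<open>\<sigma> = (s\<^sub>1, \<dots>, s\<^sub>n) : X \<rightarrow> X\<^sup>n\<close>. The image
  of \<open>\<sigma>\<close> is that of the endomorphism \<open>m \<mapsto> \<sigma>(m\<^sub>k)\<close> of \<open>X\<^sup>n\<close>, hence a direct summand; let \<open>e\<close> be a
  projection onto it, with matrix \<open>(e\<^sub>i\<^sub>j)\<close> over \<open>S\<close>. A row \<open>t \<in> S\<^sup>n = Hom(X\<^sup>n, X)\<close> satisfies
  \<open>t\<sigma> = 0\<close> if and only if \<open>te = 0\<close>, and \<open>e\<sigma> = \<sigma>\<close>. So \<open>t\<sigma> \<mapsto> te\<close> is a well-defined section of the
  surjection \<open>t \<mapsto> t\<sigma>\<close> of \<open>S\<^sup>n\<close> onto the left ideal, which is therefore projective.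
\<close>

section \<open>Finite sums\<close>

text \<open>Additivity forces \<open>f\<close> to send zero to zero, and induction on a finite
  \<Lambda> does the rest. Over an infinite \<Lambda> both sums take the default value zero. The
  lemma is applied below to scalar multiplication, to the inclusion of an ideal, to coordinates and
  to evaluation at a point.\<close>

lemma finsum_hom:
  assumes "abelian_group M" "abelian_group N" and f: "f \<in> hom (add_monoid M) (add_monoid N)"
    and g: "g \<in> \<Lambda> \<rightarrow> carrier M"
  shows "f (finsum M g \<Lambda>) = finsum N (\<lambda>i. f (g i)) \<Lambda>"
proof -
  interpret M: abelian_group M by fact
  interpret N: abelian_group N by fact
  have add: "f (x \<oplus>\<^bsub>M\<^esub> y) = f x \<oplus>\<^bsub>N\<^esub> f y" if "x \<in> carrier M" "y \<in> carrier M" for x y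
    using f that by (auto simp: hom_def)
  have cl: "f x \<in> carrier N" if "x \<in> carrier M" for x
    using f that by (auto simp: hom_def)
  \<comment> \<open>Zero equals its own double, so its image equals its own double as well;
    cancellation makes that image zero.\<close>
  have zero: "f \<zero>\<^bsub>M\<^esub> = \<zero>\<^bsub>N\<^esub>"
    using add[of "\<zero>\<^bsub>M\<^esub>" "\<zero>\<^bsub>M\<^esub>"] cl[of "\<zero>\<^bsub>M\<^esub>"] N.add.l_cancel_one[of "f \<zero>\<^bsub>M\<^esub>" "f \<zero>\<^bsub>M\<^esub>"]
    by simp
  show ?thesis
  proof (cases "finite \<Lambda>")
    case True
    then show ?thesis using g
    proof (induction \<Lambda> rule: finite_induct)
      case (insert i \<Lambda>)
      then have "g \<in> \<Lambda> \<rightarrow> carrier M" "g i \<in> carrier M" by auto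
      moreover have "(\<lambda>i. f (g i)) \<in> \<Lambda> \<rightarrow> carrier N" "f (g i) \<in> carrier N"
        using calculation cl by auto
      ultimately show ?case using insert by (simp add: add)
    qed (simp add: zero)
  qed (simp add: zero M.add.finprod_infinite N.add.finprod_infinite)
qed

lemma (in abelian_group) finsum_in_additive_subgroup:
  assumes "additive_subgroup H G" and "f \<in> \<Lambda> \<rightarrow> H"
  shows "finsum G f \<Lambda> \<in> H"
proof -
  interpret H: additive_subgroup H G by fact
  have "H \<subseteq> carrier G" by (rule H.a_subset)
  show ?thesis
  proof (cases "finite \<Lambda>")
    case True
    then show ?thesis using assms(2)
    proof (induction \<Lambda> rule: finite_induct)
      case (insert i \<Lambda>)
      then have "f \<in> \<Lambda> \<rightarrow> carrier G" "f i \<in> carrier G" using \<open>H \<subseteq> carrier G\<close> by auto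
      then show ?case using insert by simp
    qed simp
  qed (simp add: add.finprod_infinite)
qed

text \<open>Interchange of summation is what makes the product of a row, a matrix and a column
  associative.\<close>

lemma (in abelian_monoid) finsum_swap:
  assumes "finite A" "finite B" and f: "\<And>i j. i \<in> A \<Longrightarrow> j \<in> B \<Longrightarrow> f i j \<in> carrier G"
  shows "(\<Oplus>i\<in>A. \<Oplus>j\<in>B. f i j) = (\<Oplus>j\<in>B. \<Oplus>i\<in>A. f i j)"
  using assms(1) f
proof (induction A rule: finite_induct)
  case (insert a A)
  have "(\<Oplus>i\<in>insert a A. \<Oplus>j\<in>B. f i j) = (\<Oplus>j\<in>B. f a j) \<oplus> (\<Oplus>j\<in>B. \<Oplus>i\<in>A. f i j)"
    using insert by (subst finsum_insert) (auto intro!: finsum_closed)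
  also have "\<dots> = (\<Oplus>j\<in>B. f a j \<oplus> (\<Oplus>i\<in>A. f i j))"
    using insert by (intro finsum_addf[symmetric]) (auto intro!: finsum_closed)
  also have "\<dots> = (\<Oplus>j\<in>B. \<Oplus>i\<in>insert a A. f i j)"
    using insert by (intro finsum_cong') (auto intro!: finsum_closed)
  finally show ?case .
qed simp

section \<open>Projective left ideals\<close>

text \<open>One half of the dual basis criterion. \<open>left_ideal_module R (carrier R)\<close> is
  the ring as a left module over itself, so the \<open>\<phi> j\<close> are linear functionals. If
  \<open>n j\<close> is a preimage of \<open>f (s j)\<close> under \<open>g\<close>, then sending
  \<open>x\<close> to the sum of the \<open>\<phi> j x\<close> times \<open>n j\<close> lifts
  \<open>f\<close>: applying \<open>g\<close> gives the sum of the \<open>\<phi> j x\<close> times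
  \<open>f (s j)\<close>, which is \<open>f x\<close> by the dual basis identity.\<close>

lemma (in ring) projective_left_moduleI_dual_basis:
  fixes P :: "('a, 'p, 'd) module_scheme"
  assumes "left_module R P" "finite \<Lambda>" and s: "s \<in> \<Lambda> \<rightarrow> carrier P"
    and \<phi>: "\<And>j. j \<in> \<Lambda> \<Longrightarrow> \<phi> j \<in> left_module_hom R P (left_ideal_module R (carrier R))"
    and dual: "\<And>x. x \<in> carrier P \<Longrightarrow> (\<Oplus>\<^bsub>P\<^esub>j\<in>\<Lambda>. \<phi> j x \<odot>\<^bsub>P\<^esub> s j) = x"
  shows "projective_left_module TYPE('n) TYPE('l) R P"
  unfolding projective_left_module_def
proof (intro conjI allI impI ballI)
  fix N :: "('a, 'n) module" and L :: "('a, 'l) module" and g f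
  assume "left_module R N" "left_module R L" and g: "g \<in> left_module_hom R N L"
    and f: "f \<in> left_module_hom R P L" and surj: "g ` carrier N = carrier L"
  interpret P: left_module R P by fact
  interpret N: left_module R N by fact
  interpret L: left_module R L by fact
  have "\<exists>n\<in>carrier N. g n = f (s j)" if "j \<in> \<Lambda>" for j
  proof -
    have "f (s j) \<in> carrier L" using f s that by (auto simp: left_module_hom_def hom_def)
    then show ?thesis using surj by (metis imageE)
  qed
  then obtain n where n: "\<And>j. j \<in> \<Lambda> \<Longrightarrow> n j \<in> carrier N" "\<And>j. j \<in> \<Lambda> \<Longrightarrow> g (n j) = f (s j)"
    by metis
  have \<phi>c: "\<phi> j x \<in> carrier R" if "j \<in> \<Lambda>" "x \<in> carrier P" for j x
    using \<phi>[OF that(1)] that by (auto simp: left_module_hom_def hom_def left_ideal_module_def)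
  have \<phi>a: "\<phi> j (x \<oplus>\<^bsub>P\<^esub> y) = \<phi> j x \<oplus> \<phi> j y"
    if "j \<in> \<Lambda>" "x \<in> carrier P" "y \<in> carrier P" for j x y
    using \<phi>[OF that(1)] that by (auto simp: left_module_hom_def hom_def left_ideal_module_def)
  have \<phi>m: "\<phi> j (a \<odot>\<^bsub>P\<^esub> x) = a \<otimes> \<phi> j x" if "j \<in> \<Lambda>" "x \<in> carrier P" "a \<in> carrier R" for j x a
    using \<phi>[OF that(1)] that by (auto simp: left_module_hom_def hom_def left_ideal_module_def)
  let ?h = "\<lambda>x. \<Oplus>\<^bsub>N\<^esub>j\<in>\<Lambda>. \<phi> j x \<odot>\<^bsub>N\<^esub> n j"
  have t: "(\<lambda>j. \<phi> j x \<odot>\<^bsub>N\<^esub> n j) \<in> \<Lambda> \<rightarrow> carrier N" if "x \<in> carrier P" for x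
    using \<phi>c n that by auto
  have hc: "?h x \<in> carrier N" if "x \<in> carrier P" for x
    by (rule N.M.finsum_closed[OF t[OF that]])
  have ha: "?h (x \<oplus>\<^bsub>P\<^esub> y) = ?h x \<oplus>\<^bsub>N\<^esub> ?h y" if "x \<in> carrier P" "y \<in> carrier P" for x y
  proof -
    have "?h (x \<oplus>\<^bsub>P\<^esub> y) = (\<Oplus>\<^bsub>N\<^esub>j\<in>\<Lambda>. \<phi> j x \<odot>\<^bsub>N\<^esub> n j \<oplus>\<^bsub>N\<^esub> \<phi> j y \<odot>\<^bsub>N\<^esub> n j)"
      using that \<phi>c n by (intro N.M.finsum_cong') (auto simp: \<phi>a N.lsmult_l_distr)
    also have "\<dots> = ?h x \<oplus>\<^bsub>N\<^esub> ?h y" using t that by (intro N.M.finsum_addf) auto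
    finally show ?thesis .
  qed
  have hm: "?h (a \<odot>\<^bsub>P\<^esub> x) = a \<odot>\<^bsub>N\<^esub> ?h x" if "x \<in> carrier P" "a \<in> carrier R" for x a
  proof -
    have "(\<lambda>y. a \<odot>\<^bsub>N\<^esub> y) \<in> hom (add_monoid N) (add_monoid N)"
      using that by (simp add: hom_def N.lsmult_r_distr)
    from finsum_hom[OF N.M.abelian_group_axioms N.M.abelian_group_axioms this t[OF that(1)]]
    have "a \<odot>\<^bsub>N\<^esub> ?h x = (\<Oplus>\<^bsub>N\<^esub>j\<in>\<Lambda>. a \<odot>\<^bsub>N\<^esub> (\<phi> j x \<odot>\<^bsub>N\<^esub> n j))" .
    also have "\<dots> = ?h (a \<odot>\<^bsub>P\<^esub> x)"
      using that \<phi>c n by (intro N.M.finsum_cong') (auto simp: \<phi>m N.lsmult_assoc)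
    finally show ?thesis by simp
  qed
  show "\<exists>h\<in>left_module_hom R P N. \<forall>x\<in>carrier P. g (h x) = f x"
  proof (intro bexI[of _ ?h] ballI)
    show "?h \<in> left_module_hom R P N"
      using hc ha hm by (auto simp: left_module_hom_def hom_def)
    fix x assume x: "x \<in> carrier P"
    have gm: "g (a \<odot>\<^bsub>N\<^esub> y) = a \<odot>\<^bsub>L\<^esub> g y" if "a \<in> carrier R" "y \<in> carrier N" for a y
      using g that by (auto simp: left_module_hom_def)
    have fm: "f (a \<odot>\<^bsub>P\<^esub> y) = a \<odot>\<^bsub>L\<^esub> f y" if "a \<in> carrier R" "y \<in> carrier P" for a y
      using f that by (auto simp: left_module_hom_def)
    have gh: "g \<in> hom (add_monoid N) (add_monoid L)" and fh: "f \<in> hom (add_monoid P) (add_monoid L)"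
      using f g by (auto simp: left_module_hom_def)
    have "g (?h x) = (\<Oplus>\<^bsub>L\<^esub>j\<in>\<Lambda>. g (\<phi> j x \<odot>\<^bsub>N\<^esub> n j))"
      by (rule finsum_hom[OF N.M.abelian_group_axioms L.M.abelian_group_axioms gh t[OF x]])
    also have "\<dots> = (\<Oplus>\<^bsub>L\<^esub>j\<in>\<Lambda>. f (\<phi> j x \<odot>\<^bsub>P\<^esub> s j))"
    proof (rule L.M.finsum_cong')
      show "(\<lambda>j. f (\<phi> j x \<odot>\<^bsub>P\<^esub> s j)) \<in> \<Lambda> \<rightarrow> carrier L"
        using fh s \<phi>c x by (auto simp: hom_def Pi_iff)
    qed (use x \<phi>c n s in \<open>auto simp: gm fm Pi_iff\<close>)
    also have "\<dots> = f (\<Oplus>\<^bsub>P\<^esub>j\<in>\<Lambda>. \<phi> j x \<odot>\<^bsub>P\<^esub> s j)"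
      using s \<phi>c x
      by (intro finsum_hom[OF P.M.abelian_group_axioms L.M.abelian_group_axioms fh, symmetric]) auto
    finally show "g (?h x) = f x" using dual[OF x] by simp
  qed
qed (fact assms(1))

text \<open>The linear combinations form a left ideal that contains every \<open>s j\<close>, and
  every left ideal that contains the \<open>s j\<close> contains these combinations. A coefficient
  family \<open>t\<close> describes each element, which is how the ideal becomes a quotient of a
  free module.\<close>

lemma (in ring) left_ideal_generated_image:
  assumes "finite \<Lambda>" and s: "s \<in> \<Lambda> \<rightarrow> carrier R"
  shows "left_ideal_generated R (s ` \<Lambda>) = {\<Oplus>i\<in>\<Lambda>. t i \<otimes> s i | t. t \<in> \<Lambda> \<rightarrow> carrier R}" (is "_ = ?I")
proof
  have cl: "(\<lambda>i. t i \<otimes> s i) \<in> \<Lambda> \<rightarrow> carrier R" if "t \<in> \<Lambda> \<rightarrow> carrier R" for t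
    using s that by auto
  have mult: "a \<otimes> (\<Oplus>i\<in>\<Lambda>. t i \<otimes> s i) = (\<Oplus>i\<in>\<Lambda>. (a \<otimes> t i) \<otimes> s i)"
    if "a \<in> carrier R" "t \<in> \<Lambda> \<rightarrow> carrier R" for a t
  proof -
    have "a \<otimes> (\<Oplus>i\<in>\<Lambda>. t i \<otimes> s i) = (\<Oplus>i\<in>\<Lambda>. a \<otimes> (t i \<otimes> s i))"
      by (rule finsum_rdistr[OF assms(1) that(1) cl[OF that(2)]])
    also have "\<dots> = (\<Oplus>i\<in>\<Lambda>. (a \<otimes> t i) \<otimes> s i)"
      using that s by (intro finsum_cong') (auto simp: m_assoc Pi_iff)
    finally show ?thesis .
  qed
  have "additive_subgroup ?I R"
  \<comment> \<open>The inverse of the additive group is rewritten as ring negation, the form in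
    which the goals below are stated.\<close>
  proof (intro additive_subgroup.intro add.subgroupI; (simp only: a_inv_def[symmetric])?)
    show "?I \<subseteq> carrier R" using cl by (auto intro!: finsum_closed)
    show "?I \<noteq> {}" by auto
    show "\<ominus> x \<in> ?I" if x': "x \<in> ?I" for x
    proof -
      obtain t where t: "t \<in> \<Lambda> \<rightarrow> carrier R" and x: "x = (\<Oplus>i\<in>\<Lambda>. t i \<otimes> s i)" using x' by blast
      \<comment> \<open>Negation is multiplication by minus one, so \<open>mult\<close> supplies the
        coefficients.\<close>
      have "\<ominus> x = \<ominus> \<one> \<otimes> x" using cl[OF t] by (simp add: x l_minus)
      also have "\<dots> = (\<Oplus>i\<in>\<Lambda>. (\<ominus> \<one> \<otimes> t i) \<otimes> s i)" unfolding x by (rule mult) (use t in auto)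
      finally show ?thesis using t by (auto intro!: exI[of _ "\<lambda>i. \<ominus> \<one> \<otimes> t i"])
    qed
    show "x \<oplus> y \<in> ?I" if xy: "x \<in> ?I" "y \<in> ?I" for x y
    proof -
      obtain t u where t: "t \<in> \<Lambda> \<rightarrow> carrier R" and x: "x = (\<Oplus>i\<in>\<Lambda>. t i \<otimes> s i)"
        and u: "u \<in> \<Lambda> \<rightarrow> carrier R" and y: "y = (\<Oplus>i\<in>\<Lambda>. u i \<otimes> s i)" using xy by blast
      have "x \<oplus> y = (\<Oplus>i\<in>\<Lambda>. t i \<otimes> s i \<oplus> u i \<otimes> s i)"
        unfolding x y using cl[OF t] cl[OF u] by (simp add: finsum_addf)
      also have "\<dots> = (\<Oplus>i\<in>\<Lambda>. (t i \<oplus> u i) \<otimes> s i)"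
        using t u s by (intro finsum_cong') (auto simp: l_distr Pi_iff)
      finally show ?thesis using t u by (auto intro!: exI[of _ "\<lambda>i. t i \<oplus> u i"])
    qed
  qed
  moreover have "a \<otimes> x \<in> ?I" if ax: "a \<in> carrier R" "x \<in> ?I" for a x
  proof -
    obtain t where t: "t \<in> \<Lambda> \<rightarrow> carrier R" and x: "x = (\<Oplus>i\<in>\<Lambda>. t i \<otimes> s i)" using ax(2) by blast
    show ?thesis unfolding x mult[OF ax(1) t]
      using t ax(1) by (auto intro!: exI[of _ "\<lambda>i. a \<otimes> t i"])
  qed
  moreover have "s j \<in> ?I" if "j \<in> \<Lambda>" for j
  proof -
    \<comment> \<open>The coefficients of the generator \<open>s j\<close> are those of the
      \<open>j\<close>-th unit row.\<close>
    have "(\<Oplus>i\<in>\<Lambda>. (if j = i then \<one> else \<zero>) \<otimes> s i) = (\<Oplus>i\<in>\<Lambda>. if j = i then s i else \<zero>)"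
      using s by (intro finsum_cong') (auto simp: Pi_iff)
    also have "\<dots> = s j" using that assms by (intro add.finprod_singleton) auto
    finally show ?thesis by (auto intro!: exI[of _ "\<lambda>i. if j = i then \<one> else \<zero>"])
  qed
  ultimately show "left_ideal_generated R (s ` \<Lambda>) \<subseteq> ?I"
    unfolding left_ideal_generated_def by (intro Inter_lower) (auto simp: left_ideal_def)
  show "?I \<subseteq> left_ideal_generated R (s ` \<Lambda>)"
    unfolding left_ideal_generated_def
  proof (intro Inter_greatest subsetI)
    fix J x assume J: "J \<in> {J. left_ideal R J \<and> s ` \<Lambda> \<subseteq> J}" and "x \<in> ?I"
    then obtain t where t: "t \<in> \<Lambda> \<rightarrow> carrier R" and x: "x = (\<Oplus>i\<in>\<Lambda>. t i \<otimes> s i)" by blast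
    show "x \<in> J" unfolding x
      by (rule finsum_in_additive_subgroup) (use J t in \<open>auto simp: left_ideal_def Pi_iff image_subset_iff\<close>)
  qed
qed

text \<open>Every left ideal contains zero, so both intersections run over the same family.\<close>

lemma (in ring) left_ideal_generated_insert_zero:
  "left_ideal_generated R (insert \<zero> G) = left_ideal_generated R G"
proof -
  have "\<zero> \<in> I" if "left_ideal R I" for I
    using that by (simp add: left_ideal_def additive_subgroup.zero_closed)
  then show ?thesis unfolding left_ideal_generated_def by (intro arg_cong[where f = Inter]) auto
qed

text \<open>
  The matrix \<open>e\<close> splits the surjection \<open>(t\<^sub>i) \<mapsto> \<Sum> t\<^sub>i s\<^sub>i\<close> of a free module onto the left ideal:
  the second condition makes \<open>\<Sum> t\<^sub>i s\<^sub>i \<mapsto> (\<Sum> t\<^sub>i e\<^sub>i\<^sub>j)\<^sub>j\<close> well defined, the first one makes it a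
  right inverse.
\<close>

lemma (in ring) projective_left_ideal_generatedI:
  assumes fin: "finite \<Lambda>" and s: "s \<in> \<Lambda> \<rightarrow> carrier R"
    and e: "\<And>i j. i \<in> \<Lambda> \<Longrightarrow> j \<in> \<Lambda> \<Longrightarrow> e i j \<in> carrier R"
    and split: "\<And>i. i \<in> \<Lambda> \<Longrightarrow> (\<Oplus>j\<in>\<Lambda>. e i j \<otimes> s j) = s i"
    and ker: "\<And>t j. t \<in> \<Lambda> \<rightarrow> carrier R \<Longrightarrow> (\<Oplus>i\<in>\<Lambda>. t i \<otimes> s i) = \<zero> \<Longrightarrow> j \<in> \<Lambda>
      \<Longrightarrow> (\<Oplus>i\<in>\<Lambda>. t i \<otimes> e i j) = \<zero>"
  shows "projective_left_module TYPE('n) TYPE('l) R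
    (left_ideal_module R (left_ideal_generated R (s ` \<Lambda>)))"
proof -
  define I where "I = left_ideal_generated R (s ` \<Lambda>)"
  \<comment> \<open>\<open>\<sigma> t\<close> is the product of the row \<open>t\<close> with the
    column \<open>s\<close>, and \<open>\<epsilon> t\<close> is the product of the row
    \<open>t\<close> with the matrix \<open>e\<close>.\<close>
  define \<sigma> where "\<sigma> t = (\<Oplus>i\<in>\<Lambda>. t i \<otimes> s i)" for t
  define \<epsilon> where "\<epsilon> t j = (\<Oplus>i\<in>\<Lambda>. t i \<otimes> e i j)" for t j
  have I: "I = {\<sigma> t | t. t \<in> \<Lambda> \<rightarrow> carrier R}"
    unfolding I_def \<sigma>_def by (rule left_ideal_generated_image[OF fin s])
  \<comment> \<open>The column \<open>c\<close> is arbitrary, so this serves both \<sigma> and each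
    column of \<open>e\<close>. Taking \<open>a\<close> to be one gives additivity, \<open>u\<close>
    to be zero gives homogeneity, and \<open>a\<close> to be minus one gives differences.\<close>
  have lin: "(\<Oplus>i\<in>\<Lambda>. (a \<otimes> t i \<oplus> u i) \<otimes> c i) = a \<otimes> (\<Oplus>i\<in>\<Lambda>. t i \<otimes> c i) \<oplus> (\<Oplus>i\<in>\<Lambda>. u i \<otimes> c i)"
    if "a \<in> carrier R" "t \<in> \<Lambda> \<rightarrow> carrier R" "u \<in> \<Lambda> \<rightarrow> carrier R" "c \<in> \<Lambda> \<rightarrow> carrier R" for a t u c
  proof -
    have "(\<Oplus>i\<in>\<Lambda>. (a \<otimes> t i \<oplus> u i) \<otimes> c i) = (\<Oplus>i\<in>\<Lambda>. a \<otimes> (t i \<otimes> c i) \<oplus> u i \<otimes> c i)"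
      using that by (intro finsum_cong') (auto simp: l_distr m_assoc Pi_iff)
    also have "\<dots> = (\<Oplus>i\<in>\<Lambda>. a \<otimes> (t i \<otimes> c i)) \<oplus> (\<Oplus>i\<in>\<Lambda>. u i \<otimes> c i)"
      using that by (intro finsum_addf) (auto simp: Pi_iff)
    also have "(\<Oplus>i\<in>\<Lambda>. a \<otimes> (t i \<otimes> c i)) = a \<otimes> (\<Oplus>i\<in>\<Lambda>. t i \<otimes> c i)"
      using that fin by (intro finsum_rdistr[symmetric]) auto
    finally show ?thesis .
  qed
  have \<sigma>lin: "\<sigma> (\<lambda>i. a \<otimes> t i \<oplus> u i) = a \<otimes> \<sigma> t \<oplus> \<sigma> u"
    if "a \<in> carrier R" "t \<in> \<Lambda> \<rightarrow> carrier R" "u \<in> \<Lambda> \<rightarrow> carrier R" for a t u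
    unfolding \<sigma>_def using lin s that by blast
  have \<epsilon>lin: "\<epsilon> (\<lambda>i. a \<otimes> t i \<oplus> u i) j = a \<otimes> \<epsilon> t j \<oplus> \<epsilon> u j"
    if "a \<in> carrier R" "t \<in> \<Lambda> \<rightarrow> carrier R" "u \<in> \<Lambda> \<rightarrow> carrier R" "j \<in> \<Lambda>" for a t u j
    unfolding \<epsilon>_def using that e by (intro lin) auto
  have \<sigma>c: "\<sigma> t \<in> carrier R" if "t \<in> \<Lambda> \<rightarrow> carrier R" for t
    unfolding \<sigma>_def using that s by (intro finsum_closed) auto
  have \<epsilon>c: "\<epsilon> t j \<in> carrier R" if "t \<in> \<Lambda> \<rightarrow> carrier R" "j \<in> \<Lambda>" for t j
    unfolding \<epsilon>_def using that e by (intro finsum_closed) auto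
  \<comment> \<open>The row \<open>u\<close> minus \<open>t\<close> is sent to zero by \<sigma>, so
    \<open>ker\<close> makes its product with \<open>e\<close> vanish too.\<close>
  have wd: "\<epsilon> t j = \<epsilon> u j" if tu: "t \<in> \<Lambda> \<rightarrow> carrier R" "u \<in> \<Lambda> \<rightarrow> carrier R" "j \<in> \<Lambda>" "\<sigma> t = \<sigma> u" for t u j
  proof -
    have c: "(\<lambda>i. \<ominus> \<one> \<otimes> t i \<oplus> u i) \<in> \<Lambda> \<rightarrow> carrier R" using tu by auto
    have "\<sigma> (\<lambda>i. \<ominus> \<one> \<otimes> t i \<oplus> u i) = \<zero>"
      using tu \<sigma>c by (subst \<sigma>lin) (auto simp: l_minus l_neg)
    from ker[OF c this[unfolded \<sigma>_def] tu(3)] have "\<ominus> \<one> \<otimes> \<epsilon> t j \<oplus> \<epsilon> u j = \<zero>"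
      using \<epsilon>lin[of "\<ominus> \<one>" t u j] tu by (simp add: \<epsilon>_def)
    then have "\<ominus> \<epsilon> t j \<oplus> \<epsilon> u j = \<zero>" using \<epsilon>c tu by (simp add: l_minus)
    then show ?thesis using \<epsilon>c tu by (metis a_inv_closed minus_equality minus_minus)
  qed
  \<comment> \<open>An arbitrary row representing \<open>x\<close> is chosen; by \<open>wd\<close>
    the value does not depend on it.\<close>
  define \<phi> where "\<phi> j x = \<epsilon> (SOME t. t \<in> \<Lambda> \<rightarrow> carrier R \<and> x = \<sigma> t) j" for j x
  have \<phi>: "\<phi> j (\<sigma> t) = \<epsilon> t j" if "t \<in> \<Lambda> \<rightarrow> carrier R" "j \<in> \<Lambda>" for t j
  proof -
    let ?u = "SOME u. u \<in> \<Lambda> \<rightarrow> carrier R \<and> \<sigma> t = \<sigma> u"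
    have "?u \<in> \<Lambda> \<rightarrow> carrier R \<and> \<sigma> t = \<sigma> ?u" by (rule someI[of _ t]) (use that in auto)
    then show ?thesis unfolding \<phi>_def using wd[OF that(1) _ that(2)] by metis
  qed
  have "left_ideal R I"
    unfolding I_def by (rule left_ideal_left_ideal_generated) (use s in auto)
  then have lm: "left_module R (left_ideal_module R I)" by (rule left_ideal_module_left_module)
  then interpret P: left_module R "left_ideal_module R I" .
  have Ic: "I \<subseteq> carrier R" using I \<sigma>c by auto
  have sI: "s ` \<Lambda> \<subseteq> I" unfolding I_def left_ideal_generated_def by auto
  show ?thesis unfolding I_def[symmetric]
  proof (rule projective_left_moduleI_dual_basis[OF lm fin, of s \<phi>])
    show "s \<in> \<Lambda> \<rightarrow> carrier (left_ideal_module R I)"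
      using sI by (auto simp: left_ideal_module_def)
  next
    fix j assume j: "j \<in> \<Lambda>"
    have "\<phi> j x \<in> carrier R" if "x \<in> I" for x
      using that j \<epsilon>c by (auto simp: I \<phi>)
    moreover have "\<phi> j (x \<oplus> y) = \<phi> j x \<oplus> \<phi> j y" if xy: "x \<in> I" "y \<in> I" for x y
    proof -
      obtain t u where t: "t \<in> \<Lambda> \<rightarrow> carrier R" "x = \<sigma> t" and u: "u \<in> \<Lambda> \<rightarrow> carrier R" "y = \<sigma> u"
        using xy I by blast
      have c: "(\<lambda>i. \<one> \<otimes> t i \<oplus> u i) \<in> \<Lambda> \<rightarrow> carrier R" using t u by auto
      show ?thesis
        using \<phi>[OF c j] \<sigma>lin[of \<one> t u] \<epsilon>lin[of \<one> t u j] t u j \<sigma>c \<epsilon>c \<phi> by simp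
    qed
    moreover have "\<phi> j (a \<otimes> x) = a \<otimes> \<phi> j x" if ax: "a \<in> carrier R" "x \<in> I" for a x
    proof -
      obtain t where t: "t \<in> \<Lambda> \<rightarrow> carrier R" "x = \<sigma> t" using ax I by blast
      have "(\<Oplus>i\<in>\<Lambda>. \<zero> \<otimes> c i) = \<zero>" if "c \<in> \<Lambda> \<rightarrow> carrier R" for c
        using that by (subst finsum_cong'[of \<Lambda> \<Lambda> "\<lambda>_. \<zero>"]) (auto simp: Pi_iff)
      then have z: "\<sigma> (\<lambda>_. \<zero>) = \<zero>" "\<epsilon> (\<lambda>_. \<zero>) j = \<zero>"
        unfolding \<sigma>_def \<epsilon>_def using s e j by auto
      have c: "(\<lambda>i. a \<otimes> t i \<oplus> \<zero>) \<in> \<Lambda> \<rightarrow> carrier R" using t ax by auto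
      show ?thesis
        using \<phi>[OF c j] \<sigma>lin[of a t "\<lambda>_. \<zero>"] \<epsilon>lin[of a t "\<lambda>_. \<zero>" j] t ax j z \<sigma>c \<epsilon>c \<phi> by simp
    qed
    ultimately show "\<phi> j \<in> left_module_hom R (left_ideal_module R I) (left_ideal_module R (carrier R))"
      by (auto simp: left_module_hom_def hom_def left_ideal_module_def)
  next
    fix x assume "x \<in> carrier (left_ideal_module R I)"
    then obtain t where t: "t \<in> \<Lambda> \<rightarrow> carrier R" and x: "x = \<sigma> t"
      by (auto simp: left_ideal_module_def I)
    \<comment> \<open>A sum in the module on \<open>I\<close> is formally a different operation from
      a sum in the ring. The inclusion of \<open>I\<close> is additive and identifies the
      two.\<close>
    have "finsum (left_ideal_module R I) (\<lambda>j. \<phi> j x \<otimes> s j) \<Lambda> = (\<Oplus>j\<in>\<Lambda>. \<phi> j x \<otimes> s j)"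
    proof (rule finsum_hom[OF P.M.abelian_group_axioms abelian_group_axioms, where f = "\<lambda>x. x"])
      show "(\<lambda>x. x) \<in> hom (add_monoid (left_ideal_module R I)) (add_monoid R)"
        using Ic by (auto simp: hom_def left_ideal_module_def)
      show "(\<lambda>j. \<phi> j x \<otimes> s j) \<in> \<Lambda> \<rightarrow> carrier (left_ideal_module R I)"
        using \<open>left_ideal R I\<close> sI \<epsilon>c t by (auto simp: left_ideal_module_def left_ideal_def x \<phi>)
    qed
    \<comment> \<open>From here on the product of \<open>t\<close>, \<open>e\<close> and
      \<open>s\<close> is reassociated: the row times matrix is expanded, the two sums are
      interchanged, and \<open>split\<close> replaces \<open>e\<close> times \<open>s\<close> by
      \<open>s\<close>.\<close>
    also have "\<dots> = (\<Oplus>j\<in>\<Lambda>. \<Oplus>i\<in>\<Lambda>. t i \<otimes> (e i j \<otimes> s j))"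
    proof (rule finsum_cong')
      fix j assume j: "j \<in> \<Lambda>"
      have "\<phi> j x \<otimes> s j = (\<Oplus>i\<in>\<Lambda>. (t i \<otimes> e i j) \<otimes> s j)"
        unfolding x \<phi>[OF t j] unfolding \<epsilon>_def using t e s j fin by (intro finsum_ldistr) auto
      also have "\<dots> = (\<Oplus>i\<in>\<Lambda>. t i \<otimes> (e i j \<otimes> s j))"
        using t e s j by (intro finsum_cong') (auto simp: m_assoc Pi_iff)
      finally show "\<phi> j x \<otimes> s j = \<dots>" .
    qed (use t e s in \<open>auto intro!: finsum_closed simp: Pi_iff\<close>)
    also have "\<dots> = (\<Oplus>i\<in>\<Lambda>. \<Oplus>j\<in>\<Lambda>. t i \<otimes> (e i j \<otimes> s j))"
      using t e s fin by (intro finsum_swap) (auto simp: Pi_iff)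
    also have "\<dots> = (\<Oplus>i\<in>\<Lambda>. t i \<otimes> s i)"
    proof (rule finsum_cong')
      fix i assume i: "i \<in> \<Lambda>"
      have "(\<Oplus>j\<in>\<Lambda>. t i \<otimes> (e i j \<otimes> s j)) = t i \<otimes> (\<Oplus>j\<in>\<Lambda>. e i j \<otimes> s j)"
        using t e s i fin by (intro finsum_rdistr[symmetric]) auto
      then show "(\<Oplus>j\<in>\<Lambda>. t i \<otimes> (e i j \<otimes> s j)) = t i \<otimes> s i" using split[OF i] by simp
    qed (use t s in auto)
    finally show "finsum (left_ideal_module R I) (\<lambda>j. \<phi> j x \<odot>\<^bsub>left_ideal_module R I\<^esub> s j) \<Lambda> = x"
      by (simp add: x \<sigma>_def left_ideal_module_def)
  qed
qed

section \<open>Direct summands\<close>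

text \<open>The projection along a complement \<open>N'\<close>: the component in \<open>N\<close>
  is unique because the two submodules meet only in zero, and it respects sums and scalars because
  both are closed under them.\<close>

lemma (in right_module) direct_summand_projection:
  assumes "direct_summand A M N"
  obtains e where "e \<in> right_module_hom A M M" "e ` carrier M \<subseteq> N" "\<And>x. x \<in> N \<Longrightarrow> e x = x"
proof -
  obtain N' where N: "right_submodule A M N" and N': "right_submodule A M N'"
    and sum: "N <+>\<^bsub>M\<^esub> N' = carrier M" and int: "N \<inter> N' = {\<zero>\<^bsub>M\<^esub>}"
    using assms by (auto simp: direct_summand_def)
  interpret N: additive_subgroup N M using N by (simp add: right_submodule_def)
  interpret N': additive_subgroup N' M using N' by (simp add: right_submodule_def)
  have c: "x \<in> carrier M" if "x \<in> N \<or> x \<in> N'" for x using that N.a_subset N'.a_subset by auto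
  \<comment> \<open>The difference of the two components in \<open>N\<close> is also a difference of
    components in \<open>N'\<close>, so it lies in the intersection.\<close>
  have uniq: "x = y" if xy: "x \<in> N" "y \<in> N" "x' \<in> N'" "y' \<in> N'" "x \<oplus>\<^bsub>M\<^esub> x' = y \<oplus>\<^bsub>M\<^esub> y'" for x y x' y'
  proof -
    have "x \<ominus>\<^bsub>M\<^esub> y = y' \<ominus>\<^bsub>M\<^esub> x'"
    proof -
      have "x \<ominus>\<^bsub>M\<^esub> y = (x \<oplus>\<^bsub>M\<^esub> x') \<oplus>\<^bsub>M\<^esub> (\<ominus>\<^bsub>M\<^esub> x' \<oplus>\<^bsub>M\<^esub> \<ominus>\<^bsub>M\<^esub> y)"
        using c xy(1-4) by (simp add: M.minus_eq M.a_assoc M.r_neg2)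
      also have "\<dots> = (y' \<oplus>\<^bsub>M\<^esub> y) \<oplus>\<^bsub>M\<^esub> (\<ominus>\<^bsub>M\<^esub> y \<oplus>\<^bsub>M\<^esub> \<ominus>\<^bsub>M\<^esub> x')"
        using c xy by (simp add: M.a_comm)
      also have "\<dots> = y' \<ominus>\<^bsub>M\<^esub> x'"
        using c xy(1-4) by (simp add: M.minus_eq M.a_assoc M.r_neg2)
      finally show ?thesis .
    qed
    moreover have "x \<ominus>\<^bsub>M\<^esub> y \<in> N" "y' \<ominus>\<^bsub>M\<^esub> x' \<in> N'"
      using xy by (simp_all add: M.minus_eq)
    ultimately have "x \<ominus>\<^bsub>M\<^esub> y = \<zero>\<^bsub>M\<^esub>" using int by auto
    then have "x \<oplus>\<^bsub>M\<^esub> \<ominus>\<^bsub>M\<^esub> y = \<zero>\<^bsub>M\<^esub>" by (simp add: M.minus_eq)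
    then show ?thesis using c xy(1,2) M.minus_equality[of x "\<ominus>\<^bsub>M\<^esub> y"] by simp
  qed
  define e where "e x = (THE n. n \<in> N \<and> (\<exists>n'\<in>N'. x = n \<oplus>\<^bsub>M\<^esub> n'))" for x
  have e: "e (n \<oplus>\<^bsub>M\<^esub> n') = n" if "n \<in> N" "n' \<in> N'" for n n'
    unfolding e_def using that uniq by (intro the_equality) auto
  have ex: "\<exists>n\<in>N. \<exists>n'\<in>N'. x = n \<oplus>\<^bsub>M\<^esub> n'" if "x \<in> carrier M" for x
    using that unfolding sum[symmetric] by (auto simp: set_add_def set_mult_def)
  show ?thesis
  proof
    show "e ` carrier M \<subseteq> N" by (auto dest!: ex simp: e)
    show "e x = x" if "x \<in> N" for x using e[of x "\<zero>\<^bsub>M\<^esub>"] that c by simp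
    have "e (x \<oplus>\<^bsub>M\<^esub> y) = e x \<oplus>\<^bsub>M\<^esub> e y" if xy: "x \<in> carrier M" "y \<in> carrier M" for x y
    proof -
      obtain n n' where n: "n \<in> N" "n' \<in> N'" "x = n \<oplus>\<^bsub>M\<^esub> n'"
        using ex[OF xy(1)] by blast
      obtain k k' where k: "k \<in> N" "k' \<in> N'" "y = k \<oplus>\<^bsub>M\<^esub> k'"
        using ex[OF xy(2)] by blast
      have "x \<oplus>\<^bsub>M\<^esub> y = (n \<oplus>\<^bsub>M\<^esub> k) \<oplus>\<^bsub>M\<^esub> (n' \<oplus>\<^bsub>M\<^esub> k')" using n k c by (simp add: M.a_ac)
      then show ?thesis using e n k by simp
    qed
    moreover have "e (x \<odot>r\<^bsub>M\<^esub> a) = e x \<odot>r\<^bsub>M\<^esub> a" if xa: "x \<in> carrier M" "a \<in> carrier A" for x a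
    proof -
      obtain n n' where n: "n \<in> N" "n' \<in> N'" "x = n \<oplus>\<^bsub>M\<^esub> n'" using ex xa by blast
      have "x \<odot>r\<^bsub>M\<^esub> a = n \<odot>r\<^bsub>M\<^esub> a \<oplus>\<^bsub>M\<^esub> n' \<odot>r\<^bsub>M\<^esub> a" using n c xa by (simp add: rsmult_l_distr)
      moreover have "n \<odot>r\<^bsub>M\<^esub> a \<in> N" "n' \<odot>r\<^bsub>M\<^esub> a \<in> N'"
        using N N' n xa by (auto simp: right_submodule_def)
      ultimately show ?thesis using e n by simp
    qed
    moreover have "e x \<in> carrier M" if "x \<in> carrier M" for x using ex[OF that] e c by auto
    ultimately show "e \<in> right_module_hom A M M" by (auto simp: right_module_hom_def hom_def)
  qed
qed

section \<open>Finite direct sums of copies\<close>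

lemma (in right_module) rsmult_zero [simp]:
  assumes "a \<in> carrier A" shows "\<zero>\<^bsub>M\<^esub> \<odot>r\<^bsub>M\<^esub> a = \<zero>\<^bsub>M\<^esub>"
  using rsmult_l_distr[of "\<zero>\<^bsub>M\<^esub>" "\<zero>\<^bsub>M\<^esub>" a] assms
  by (metis M.add.l_cancel_one M.l_zero M.zero_closed rsmult_closed)

text \<open>Over a finite index set the finite support condition is automatic, and the direct sum is
  the full product.\<close>

lemma (in right_module) carrier_direct_sum_copies:
  assumes "finite \<Lambda>"
  shows "carrier (direct_sum_copies \<Lambda> M) = (\<Pi>\<^sub>E i\<in>\<Lambda>. carrier M)"
  using assms by (simp add: direct_sum_copies_def carrier_sum_group M.a_group)

lemma add_direct_sum_copies:
  "x \<oplus>\<^bsub>direct_sum_copies \<Lambda> M\<^esub> y = (\<lambda>i\<in>\<Lambda>. x i \<oplus>\<^bsub>M\<^esub> y i)"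
  by (simp add: direct_sum_copies_def)

lemma rsmult_direct_sum_copies:
  "x \<odot>r\<^bsub>direct_sum_copies \<Lambda> M\<^esub> a = (\<lambda>i\<in>\<Lambda>. x i \<odot>r\<^bsub>M\<^esub> a)"
  by (simp add: direct_sum_copies_def)

section \<open>Homomorphisms as elements of the endomorphism ring\<close>

lemma endo_ring_simps:
  "carrier (endo_ring A M) = right_module_hom A M M \<inter> extensional (carrier M)"
  "f \<otimes>\<^bsub>endo_ring A M\<^esub> g = compose (carrier M) f g"
  "\<zero>\<^bsub>endo_ring A M\<^esub> = (\<lambda>x\<in>carrier M. \<zero>\<^bsub>M\<^esub>)"
  "f \<oplus>\<^bsub>endo_ring A M\<^esub> g = (\<lambda>x\<in>carrier M. f x \<oplus>\<^bsub>M\<^esub> g x)"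
  by (simp_all add: endo_ring_def)

lemma right_module_homD:
  assumes "f \<in> right_module_hom A M N"
  shows "f \<in> hom (add_monoid M) (add_monoid N)"
    and "x \<in> carrier M \<Longrightarrow> f x \<in> carrier N"
    and "x \<in> carrier M \<Longrightarrow> y \<in> carrier M \<Longrightarrow> f (x \<oplus>\<^bsub>M\<^esub> y) = f x \<oplus>\<^bsub>N\<^esub> f y"
    and "x \<in> carrier M \<Longrightarrow> a \<in> carrier A \<Longrightarrow> f (x \<odot>r\<^bsub>M\<^esub> a) = f x \<odot>r\<^bsub>N\<^esub> a"
  using assms by (auto simp: right_module_hom_def hom_def)

lemma right_module_homI:
  assumes "\<And>x. x \<in> carrier M \<Longrightarrow> f x \<in> carrier N"
    and "\<And>x y. x \<in> carrier M \<Longrightarrow> y \<in> carrier M \<Longrightarrow> f (x \<oplus>\<^bsub>M\<^esub> y) = f x \<oplus>\<^bsub>N\<^esub> f y"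
    and "\<And>x a. x \<in> carrier M \<Longrightarrow> a \<in> carrier A \<Longrightarrow> f (x \<odot>r\<^bsub>M\<^esub> a) = f x \<odot>r\<^bsub>N\<^esub> a"
  shows "f \<in> right_module_hom A M N"
  using assms by (auto simp: right_module_hom_def hom_def)

text \<open>Elements of \<open>endo_ring\<close> are extensional, so a homomorphism has to be made
  undefined outside the carrier; on the carrier nothing changes.\<close>

lemma (in right_module) restrict_endo:
  assumes "f \<in> right_module_hom A M M"
  shows "restrict f (carrier M) \<in> carrier (endo_ring A M)"
  using right_module_homD[OF assms] unfolding endo_ring_simps
  by (auto intro!: right_module_homI)

text \<open>Evaluation at \<open>x\<close> is an additive map from the endomorphism ring to the
  module.\<close>

lemma (in right_module) finsum_endo_ring_apply:
  assumes "f \<in> \<Lambda> \<rightarrow> carrier (endo_ring A M)" "x \<in> carrier M"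
  shows "finsum (endo_ring A M) f \<Lambda> x = finsum M (\<lambda>i. f i x) \<Lambda>"
proof (rule finsum_hom[where f = "\<lambda>h. h x"])
  show "abelian_group (endo_ring A M)" using endo_ring_is_ring by (rule ring.is_abelian_group)
  show "(\<lambda>h. h x) \<in> hom (add_monoid (endo_ring A M)) (add_monoid M)"
    using assms(2) by (auto simp: hom_def endo_ring_simps dest: right_module_homD)
qed (use assms in \<open>auto simp: M.abelian_group_axioms\<close>)

text \<open>The matrix of a projection \<open>e\<close> onto the image of the column \<sigma> meets
  both conditions of \<open>projective_left_ideal_generatedI\<close>: \<open>e\<close> fixes the
  image of \<sigma>, which gives the splitting, and \<open>e\<close> maps into that image, which
  gives the condition on kernels.\<close>

lemma (in right_module) projective_left_ideal_generated_endo: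
  assumes fin: "finite \<Lambda>" and ne: "\<Lambda> \<noteq> {}" and s: "s \<in> \<Lambda> \<rightarrow> carrier (endo_ring A M)"
    and dr: "d_rickart A (direct_sum_copies \<Lambda> M)"
  shows "projective_left_module TYPE('n) TYPE('l) (endo_ring A M)
    (left_ideal_module (endo_ring A M) (left_ideal_generated (endo_ring A M) (s ` \<Lambda>)))"
proof -
  let ?S = "endo_ring A M" and ?D = "direct_sum_copies \<Lambda> M"
  interpret S: ring ?S by (rule endo_ring_is_ring)
  interpret D: right_module A ?D by (rule direct_sum_copies_right_module)
  note cD = carrier_direct_sum_copies[OF fin]
  note opD = add_direct_sum_copies rsmult_direct_sum_copies
  have sh: "s i \<in> right_module_hom A M M" if "i \<in> \<Lambda>" for i
    using s that by (auto simp: endo_ring_simps)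
  define \<sigma> where "\<sigma> x = (\<lambda>i\<in>\<Lambda>. s i x)" for x
  have \<sigma>: "\<sigma> \<in> right_module_hom A M ?D"
    by (rule right_module_homI)
      (simp_all add: \<sigma>_def cD opD right_module_homD[OF sh] cong: restrict_cong)
  obtain k where k: "k \<in> \<Lambda>" using ne by auto
  \<comment> \<open>The d-Rickart property speaks of endomorphisms, whereas \<sigma> starts at a
    single copy. Composing with the projection to coordinate \<open>k\<close> turns \<sigma> into an
    endomorphism of the direct sum with the same image.\<close>
  let ?p = "\<lambda>m\<in>carrier ?D. \<sigma> (m k)"
  have mk: "m i \<in> carrier M" if "m \<in> carrier ?D" "i \<in> \<Lambda>" for m i using that by (auto simp: cD)
  have "(\<lambda>m. \<sigma> (m k)) \<in> right_module_hom A ?D ?D"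
  proof (rule right_module_homI)
    show "\<sigma> (m k) \<in> carrier ?D" if "m \<in> carrier ?D" for m
      using right_module_homD(2)[OF \<sigma>] mk that k by blast
    show "\<sigma> ((m \<oplus>\<^bsub>?D\<^esub> m') k) = \<sigma> (m k) \<oplus>\<^bsub>?D\<^esub> \<sigma> (m' k)"
      if "m \<in> carrier ?D" "m' \<in> carrier ?D" for m m'
      using right_module_homD(3)[OF \<sigma> mk[OF _ k] mk[OF _ k]] that k by (simp add: add_direct_sum_copies[where x = m])
    show "\<sigma> ((m \<odot>r\<^bsub>?D\<^esub> a) k) = \<sigma> (m k) \<odot>r\<^bsub>?D\<^esub> a"
      if "m \<in> carrier ?D" "a \<in> carrier A" for m a
      using right_module_homD(4)[OF \<sigma> mk[OF _ k]] that k by (simp add: rsmult_direct_sum_copies[where x = m])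
  qed
  then have "?p \<in> carrier (endo_ring A ?D)" by (rule D.restrict_endo)
  then have "direct_summand A ?D (?p ` carrier ?D)" using dr by (auto simp: d_rickart_def)
  moreover have "?p ` carrier ?D = \<sigma> ` carrier M"
  proof (intro equalityI subsetI)
    \<comment> \<open>The constant family with value \<open>x\<close> has \<open>k\<close>-th
      coordinate \<open>x\<close>, so the projection to that coordinate is onto.\<close>
    fix y assume "y \<in> \<sigma> ` carrier M"
    then obtain x where x: "x \<in> carrier M" "y = \<sigma> x" by auto
    then have "(\<lambda>_\<in>\<Lambda>. x) \<in> carrier ?D" "y = ?p (\<lambda>_\<in>\<Lambda>. x)" using k by (auto simp: cD)
    then show "y \<in> ?p ` carrier ?D" by blast
  qed (use mk k in auto)
  ultimately have "direct_summand A ?D (\<sigma> ` carrier M)" by simp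
  then obtain e where e: "e \<in> right_module_hom A ?D ?D" and e_im: "e ` carrier ?D \<subseteq> \<sigma> ` carrier M"
    and e_id: "\<And>x. x \<in> \<sigma> ` carrier M \<Longrightarrow> e x = x"
    by (rule D.direct_summand_projection) blast
  \<comment> \<open>\<open>\<iota> j\<close> is the injection of the \<open>j\<close>-th copy; for
    \<open>j\<close> outside \<Lambda> it is the zero map, so it is a homomorphism for every
    \<open>j\<close>.\<close>
  define \<iota> where "\<iota> j x = (\<lambda>i\<in>\<Lambda>. if i = j then x else \<zero>\<^bsub>M\<^esub>)" for j x
  have \<iota>: "\<iota> j \<in> right_module_hom A M ?D" for j
    by (rule right_module_homI) (simp_all add: \<iota>_def cD opD PiE_iff fun_eq_iff)
  \<comment> \<open>The entry of the matrix of \<open>e\<close> in row \<open>i\<close> and column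
    \<open>j\<close>.\<close>
  define \<epsilon> where "\<epsilon> i j = (\<lambda>x\<in>carrier M. e (\<iota> j x) i)" for i j
  have comp: "(m \<oplus>\<^bsub>?D\<^esub> m') i = m i \<oplus>\<^bsub>M\<^esub> m' i" "(m \<odot>r\<^bsub>?D\<^esub> a) i = m i \<odot>r\<^bsub>M\<^esub> a" if "i \<in> \<Lambda>" for m m' a i
    using that by (simp_all add: opD)
  have eval: "(\<lambda>m. m i) \<in> hom (add_monoid ?D) (add_monoid M)" if "i \<in> \<Lambda>" for i
    using that mk by (auto simp: hom_def comp)
  have \<epsilon>: "\<epsilon> i j \<in> carrier ?S" if "i \<in> \<Lambda>" for i j
    unfolding \<epsilon>_def
    by (intro restrict_endo right_module_homI)
      (use that in \<open>simp_all add: right_module_homD[OF e] right_module_homD[OF \<iota>] comp mk\<close>)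
  show ?thesis
  proof (rule S.projective_left_ideal_generatedI[OF fin s, of \<epsilon>])
    fix i j assume "i \<in> \<Lambda>" "j \<in> \<Lambda>" then show "\<epsilon> i j \<in> carrier ?S" by (simp add: \<epsilon>)
  next
    fix i assume i: "i \<in> \<Lambda>"
    have c: "(\<lambda>j. \<epsilon> i j \<otimes>\<^bsub>?S\<^esub> s j) \<in> \<Lambda> \<rightarrow> carrier ?S" using \<epsilon>[OF i] s by auto
    show "(\<Oplus>\<^bsub>?S\<^esub>j\<in>\<Lambda>. \<epsilon> i j \<otimes>\<^bsub>?S\<^esub> s j) = s i"
    \<comment> \<open>Both sides are extensional, so it suffices to compare them at the points of
      the carrier.\<close>
    proof (rule extensionalityI)
      show "(\<Oplus>\<^bsub>?S\<^esub>j\<in>\<Lambda>. \<epsilon> i j \<otimes>\<^bsub>?S\<^esub> s j) \<in> extensional (carrier M)"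
        using S.finsum_closed[OF c] unfolding endo_ring_simps(1) by blast
      show "s i \<in> extensional (carrier M)" using s i by (auto simp: endo_ring_simps)
      fix x assume x: "x \<in> carrier M"
      have sx: "s j x \<in> carrier M" if "j \<in> \<Lambda>" for j using right_module_homD(2)[OF sh] that x by blast
      have \<iota>s: "(\<lambda>j. \<iota> j (s j x)) \<in> \<Lambda> \<rightarrow> carrier ?D" using right_module_homD(2)[OF \<iota>] sx by auto
      \<comment> \<open>A tuple is the sum of its injected coordinates. With the additivity of
        \<open>e\<close> this turns the sum of the \<open>\<epsilon> i j (s j x)\<close> into the
        \<open>i\<close>-th coordinate of \<open>e (\<sigma> x)\<close>.\<close>
      have sum: "finsum ?D (\<lambda>j. \<iota> j (s j x)) \<Lambda> = \<sigma> x"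
      proof (rule extensionalityI)
        show "finsum ?D (\<lambda>j. \<iota> j (s j x)) \<Lambda> \<in> extensional \<Lambda>"
          using D.M.finsum_closed[OF \<iota>s] unfolding cD by (auto simp: PiE_def)
        show "\<sigma> x \<in> extensional \<Lambda>" by (simp add: \<sigma>_def)
        fix l assume l: "l \<in> \<Lambda>"
        have "finsum ?D (\<lambda>j. \<iota> j (s j x)) \<Lambda> l = finsum M (\<lambda>j. \<iota> j (s j x) l) \<Lambda>"
          by (rule finsum_hom[OF D.M.abelian_group_axioms M.abelian_group_axioms eval[OF l] \<iota>s])
        also have "\<dots> = finsum M (\<lambda>j. if l = j then s j x else \<zero>\<^bsub>M\<^esub>) \<Lambda>"
          using l sx by (intro M.finsum_cong') (auto simp: \<iota>_def)
        also have "\<dots> = s l x" using l sx fin by (intro M.add.finprod_singleton) auto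
        finally show "finsum ?D (\<lambda>j. \<iota> j (s j x)) \<Lambda> l = \<sigma> x l" using l by (simp add: \<sigma>_def)
      qed
      have "(\<Oplus>\<^bsub>?S\<^esub>j\<in>\<Lambda>. \<epsilon> i j \<otimes>\<^bsub>?S\<^esub> s j) x = finsum M (\<lambda>j. (\<epsilon> i j \<otimes>\<^bsub>?S\<^esub> s j) x) \<Lambda>"
        by (rule finsum_endo_ring_apply[OF c x])
      also have "\<dots> = finsum M (\<lambda>j. e (\<iota> j (s j x)) i) \<Lambda>"
        by (rule M.finsum_cong')
          (use x sx mk[OF right_module_homD(2)[OF e right_module_homD(2)[OF \<iota>]] i] in
            \<open>simp_all add: endo_ring_simps compose_def \<epsilon>_def\<close>)
      also have "\<dots> = finsum ?D (\<lambda>j. e (\<iota> j (s j x))) \<Lambda> i"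
        using \<iota>s right_module_homD(2)[OF e]
        by (intro finsum_hom[OF D.M.abelian_group_axioms M.abelian_group_axioms eval[OF i], symmetric]) auto
      also have "finsum ?D (\<lambda>j. e (\<iota> j (s j x))) \<Lambda> = e (\<sigma> x)"
        unfolding sum[symmetric]
        by (rule finsum_hom[OF D.M.abelian_group_axioms D.M.abelian_group_axioms
              right_module_homD(1)[OF e] \<iota>s, symmetric])
      also have "\<dots> i = s i x" using e_id x i by (simp add: \<sigma>_def)
      finally show "(\<Oplus>\<^bsub>?S\<^esub>j\<in>\<Lambda>. \<epsilon> i j \<otimes>\<^bsub>?S\<^esub> s j) x = s i x" .
    qed
  next
    fix t j assume t: "t \<in> \<Lambda> \<rightarrow> carrier ?S" and 0: "(\<Oplus>\<^bsub>?S\<^esub>i\<in>\<Lambda>. t i \<otimes>\<^bsub>?S\<^esub> s i) = \<zero>\<^bsub>?S\<^esub>"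
      and j: "j \<in> \<Lambda>"
    have c: "(\<lambda>i. t i \<otimes>\<^bsub>?S\<^esub> \<epsilon> i j) \<in> \<Lambda> \<rightarrow> carrier ?S" using \<epsilon> t by auto
    have c': "(\<lambda>i. t i \<otimes>\<^bsub>?S\<^esub> s i) \<in> \<Lambda> \<rightarrow> carrier ?S" using s t by auto
    have th: "t i \<in> right_module_hom A M M" if "i \<in> \<Lambda>" for i
      using t that by (auto simp: endo_ring_simps)
    show "(\<Oplus>\<^bsub>?S\<^esub>i\<in>\<Lambda>. t i \<otimes>\<^bsub>?S\<^esub> \<epsilon> i j) = \<zero>\<^bsub>?S\<^esub>"
    proof (rule extensionalityI)
      show "(\<Oplus>\<^bsub>?S\<^esub>i\<in>\<Lambda>. t i \<otimes>\<^bsub>?S\<^esub> \<epsilon> i j) \<in> extensional (carrier M)"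
        using S.finsum_closed[OF c] unfolding endo_ring_simps(1) by blast
      show "\<zero>\<^bsub>?S\<^esub> \<in> extensional (carrier M)" by (simp add: endo_ring_simps)
      fix x assume x: "x \<in> carrier M"
      have "\<iota> j x \<in> carrier ?D" using right_module_homD(2)[OF \<iota>] x by blast
      \<comment> \<open>The \<open>j\<close>-th column of the matrix, evaluated at \<open>x\<close>,
        is \<open>\<sigma> y\<close> for a single \<open>y\<close>. The sum of the
        \<open>t i\<close> after \<open>\<epsilon> i j\<close> at \<open>x\<close> is therefore the
        sum of the \<open>t i\<close> after \<open>s i\<close> at \<open>y\<close>, which is zero by
        assumption.\<close>
      then obtain y where y: "y \<in> carrier M" "e (\<iota> j x) = \<sigma> y" using e_im by blast
      have sy: "s i y \<in> carrier M" if "i \<in> \<Lambda>" for i using right_module_homD(2)[OF sh] that y by blast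
      have "(\<Oplus>\<^bsub>?S\<^esub>i\<in>\<Lambda>. t i \<otimes>\<^bsub>?S\<^esub> \<epsilon> i j) x = finsum M (\<lambda>i. (t i \<otimes>\<^bsub>?S\<^esub> \<epsilon> i j) x) \<Lambda>"
        by (rule finsum_endo_ring_apply[OF c x])
      also have "\<dots> = finsum M (\<lambda>i. (t i \<otimes>\<^bsub>?S\<^esub> s i) y) \<Lambda>"
        by (rule M.finsum_cong')
          (use x y sy right_module_homD(2)[OF th] in
            \<open>auto simp: endo_ring_simps compose_def \<epsilon>_def \<sigma>_def\<close>)
      also have "\<dots> = (\<Oplus>\<^bsub>?S\<^esub>i\<in>\<Lambda>. t i \<otimes>\<^bsub>?S\<^esub> s i) y"
        by (rule finsum_endo_ring_apply[OF c' y(1), symmetric])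
      finally show "(\<Oplus>\<^bsub>?S\<^esub>i\<in>\<Lambda>. t i \<otimes>\<^bsub>?S\<^esub> \<epsilon> i j) x = \<zero>\<^bsub>?S\<^esub> x"
        using x y unfolding 0 by (simp add: endo_ring_simps(3))
    qed
  qed
qed

section \<open>From finite generating sets to families indexed by subsets of the index type\<close>

theorem proposition5p1:
  fixes A :: "('a, 'c) ring_scheme" and X :: "('a, 'x, 'd) rmodule_scheme"
  assumes "ring A" and "right_module A X"
    and "sigma_d_rickart TYPE('i::infinite) A X"
  shows "left_semi_hereditary TYPE('n) TYPE('l) (endo_ring A X)"
proof -
  let ?S = "endo_ring A X"
  interpret X: right_module A X by fact
  interpret S: ring ?S by (rule X.endo_ring_is_ring)
  show ?thesis unfolding left_semi_hereditary_def
  proof (intro conjI allI impI)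
    show "ring ?S" by (rule S.ring_axioms)
    fix I assume "fg_left_ideal ?S I"
    then obtain G where G: "finite G" "G \<subseteq> carrier ?S" and I: "I = left_ideal_generated ?S G"
      by (auto simp: fg_left_ideal_def)
    \<comment> \<open>adjoining \<open>\<zero>\<close> makes the index set non-empty also when \<open>G\<close> is empty\<close>
    let ?G = "insert \<zero>\<^bsub>?S\<^esub> G"
    \<comment> \<open>An infinite type has finite subsets of every size, so the generators can be
      enumerated bijectively by a subset of \<open>'i\<close>, over which the d-Rickart assumption
      applies.\<close>
    obtain \<Lambda> :: "'i set" where \<Lambda>: "finite \<Lambda>" "card \<Lambda> = card ?G"
      using infinite_arbitrarily_large[OF infinite_UNIV, of "card ?G"] by blast
    then obtain s where "bij_betw s \<Lambda> ?G"
      using finite_same_card_bij G(1) by (metis finite_insert)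
    then have s: "s ` \<Lambda> = ?G" by (simp add: bij_betw_def)
    then have "\<Lambda> \<noteq> {}" by auto
    moreover from this have "d_rickart A (direct_sum_copies \<Lambda> X)"
      using assms(3) by (simp add: sigma_d_rickart_def)
    moreover have "s \<in> \<Lambda> \<rightarrow> carrier ?S" using equalityD1[OF s] G(2) S.zero_closed by (fastforce simp: image_subset_iff)
    ultimately have "projective_left_module TYPE('n) TYPE('l) ?S
        (left_ideal_module ?S (left_ideal_generated ?S (s ` \<Lambda>)))"
      using X.projective_left_ideal_generated_endo[OF \<Lambda>(1)] by blast
    then show "projective_left_module TYPE('n) TYPE('l) ?S (left_ideal_module ?S I)"
      unfolding s I S.left_ideal_generated_insert_zero .
  qed
qed

end
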